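(* Let $\mathcal{S}$ be a self-adjoint (multiplicative) semigroup of positive operators on the Banach lattice $l^2$, and let $\mathcal{S}_+$ denote the set of all positive semidefinite operators in $\mathcal{S}$. Suppose that either: (i) $\mathcal{S}$ consists of trace-class operators and the set $\{ \operatorname{tr} S : S \in \mathcal{S}_+ \}$ is finite, or (ii) for each $i \in \mathbb{N}$ the set $\{ S_{ii} : S \in \mathcal{S}_+ \}$ is finite. Then, for every $S \in \mathcal{S}$, the nonzero entries of (the matrix of) $S$ are of the form $\sqrt{\xi \eta}$, where $\xi$ and $\eta$ are diagonal entries of the projections $S S^*$ and $S^* S$, respectively.
   Context: Here $l^2$ is the real or complex Hilbert space of square-summable sequences indexed by $\mathbb{N}$, regarded also as a Banach lattice with the coordinatewise order. Each bounded operator $T$ on $l^2$ is represented by its infinite matrix $(T_{ij})_{i,j \in \mathbb{N}}$ with respect to the standard basis of $l^2$; "entries" and "diagonal entries" refer to this matrix. An operator on $l^2$ is positive in the Banach lattice sense if it maps nonnegative vectors to nonnegative vectors, i.e. all its matrix entries are nonnegative; this differs from positive semidefinite (self-adjoint with $\langle Tx, x\rangle \ge 0$ for all $x$). A collection $\mathcal{C}$ of operators on $l^2$ is called self-adjoint if $T \in \mathcal{C}$ implies $T^* \in \mathcal{C}$. A projection is a self-adjoint idempotent. *)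

theory Defs
  imports "HOL-Analysis.Analysis"
begin

text \<open>
  The class below has, up to isomorphism, exactly two members: the real field with the trivial
  conjugation and the complex field with complex conjugation. Indeed, a real normed field is
  isometrically isomorphic to the real or to the complex numbers, and the last axiom determines
  the conjugation. A statement over this class is a statement about both scalar fields.
\<close>

class real_or_complex = real_normed_field + banach +
  fixes conjugate :: "'a \<Rightarrow> 'a"
  assumes conjugate_add: "conjugate (a + b) = conjugate a + conjugate b"
    and conjugate_mult: "conjugate (a * b) = conjugate a * conjugate b"
    and conjugate_conjugate: "conjugate (conjugate a) = a"
    and mult_conjugate: "a * conjugate a = (norm a * norm a) *\<^sub>R 1"

instantiation real :: real_or_complex
begin
definition conjugate_real :: "real \<Rightarrow> real" where "conjugate_real a = a"
instance
  by standard (simp_all add: conjugate_real_def power2_eq_square)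
end

instantiation complex :: real_or_complex
begin
definition conjugate_complex :: "complex \<Rightarrow> complex" where "conjugate_complex a = cnj a"
instance
  by standard
    (simp_all add: conjugate_complex_def complex_eq_iff cmod_def flip: power2_eq_square)
end

definition nonneg_scalar :: "'a::real_or_complex \<Rightarrow> bool" where
  "nonneg_scalar a \<longleftrightarrow> (\<exists>r\<ge>0. a = of_real r)"

typedef (overloaded) 'a l2 = "{x :: nat \<Rightarrow> 'a::real_or_complex. summable (\<lambda>n. (norm (x n))\<^sup>2)}"
  morphisms coord Abs_l2
  by (rule exI [of _ "\<lambda>_. 0"]) simp

setup_lifting type_definition_l2

lemma summable_coord: "summable (\<lambda>n. (norm (coord x n))\<^sup>2)"
  using coord [of x] by simp

lemma square_summable_add:
  fixes x y :: "nat \<Rightarrow> 'a::real_or_complex"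
  assumes "summable (\<lambda>n. (norm (x n))\<^sup>2)" "summable (\<lambda>n. (norm (y n))\<^sup>2)"
  shows "summable (\<lambda>n. (norm (x n + y n))\<^sup>2)"
proof (rule summable_comparison_test')
  show "summable (\<lambda>n. 2 * (norm (x n))\<^sup>2 + 2 * (norm (y n))\<^sup>2)"
    using assms by (intro summable_add summable_mult)
  fix n
  have "(norm (x n + y n))\<^sup>2 \<le> (norm (x n) + norm (y n))\<^sup>2"
    by (simp add: norm_triangle_ineq power_mono)
  also have "\<dots> \<le> 2 * (norm (x n))\<^sup>2 + 2 * (norm (y n))\<^sup>2"
    using sum_squares_bound [of "norm (x n)" "norm (y n)"] by (simp add: power2_sum)
  finally show "norm ((norm (x n + y n))\<^sup>2) \<le> 2 * (norm (x n))\<^sup>2 + 2 * (norm (y n))\<^sup>2"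
    by simp
qed

lemma square_summable_mult:
  fixes x :: "nat \<Rightarrow> 'a::real_or_complex"
  assumes "summable (\<lambda>n. (norm (x n))\<^sup>2)"
  shows "summable (\<lambda>n. (norm (c * x n))\<^sup>2)"
  using summable_mult [OF assms, of "(norm c)\<^sup>2"] by (simp add: norm_mult power_mult_distrib)

lift_definition scale_l2 :: "'a::real_or_complex \<Rightarrow> 'a l2 \<Rightarrow> 'a l2" is "\<lambda>c x n. c * x n"
  by (rule square_summable_mult)

lift_definition unit_l2 :: "nat \<Rightarrow> 'a::real_or_complex l2" is "\<lambda>i n. if n = i then 1 else 0"
proof -
  fix i :: nat
  show "summable (\<lambda>n. (norm (if n = i then 1 else 0 :: 'a))\<^sup>2)"
    by (rule summable_finite [of "{i}"]) auto
qed

instantiation l2 :: (real_or_complex) real_normed_vector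
begin

lift_definition zero_l2 :: "'a l2" is "\<lambda>_. 0" by simp
lift_definition plus_l2 :: "'a l2 \<Rightarrow> 'a l2 \<Rightarrow> 'a l2" is "\<lambda>x y n. x n + y n"
  by (rule square_summable_add)
lift_definition uminus_l2 :: "'a l2 \<Rightarrow> 'a l2" is "\<lambda>x n. - x n" by simp
lift_definition minus_l2 :: "'a l2 \<Rightarrow> 'a l2 \<Rightarrow> 'a l2" is "\<lambda>x y n. x n - y n"
proof -
  fix x y :: "nat \<Rightarrow> 'a"
  assume "summable (\<lambda>n. (norm (x n))\<^sup>2)" "summable (\<lambda>n. (norm (y n))\<^sup>2)"
  then show "summable (\<lambda>n. (norm (x n - y n))\<^sup>2)"
    using square_summable_add [of x "\<lambda>n. - y n"] by simp
qed
lift_definition scaleR_l2 :: "real \<Rightarrow> 'a l2 \<Rightarrow> 'a l2" is "\<lambda>r x n. r *\<^sub>R x n"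
  unfolding scaleR_conv_of_real by (rule square_summable_mult)
lift_definition norm_l2 :: "'a l2 \<Rightarrow> real" is "\<lambda>x. sqrt (\<Sum>n. (norm (x n))\<^sup>2)" .

definition dist_l2 :: "'a l2 \<Rightarrow> 'a l2 \<Rightarrow> real" where "dist_l2 x y = norm (x - y)"
definition sgn_l2 :: "'a l2 \<Rightarrow> 'a l2" where "sgn_l2 x = inverse (norm x) *\<^sub>R x"
definition uniformity_l2 :: "('a l2 \<times> 'a l2) filter" where
  "uniformity_l2 = (INF e\<in>{0<..}. principal {(x, y). dist x y < e})"
definition open_l2 :: "'a l2 set \<Rightarrow> bool" where
  "open_l2 U = (\<forall>x\<in>U. eventually (\<lambda>(x', y). x' = x \<longrightarrow> y \<in> U) uniformity)"

lemma norm_l2_nonneg: "0 \<le> norm (x :: 'a l2)"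
  by transfer (simp add: suminf_nonneg)

lemma L2_set_le_norm_l2: "L2_set (\<lambda>n. norm (coord x n)) {..<N} \<le> norm x"
  unfolding L2_set_def norm_l2.rep_eq
  by (intro real_sqrt_le_mono sum_le_suminf summable_coord) auto

instance
proof
  fix x y z :: "'a l2" and a b :: real
  show "x + y + z = x + (y + z)" "x + y = y + x" "0 + x = x" "- x + x = 0" "x - y = x + - y"
    by (transfer; simp add: fun_eq_iff add.assoc add.commute)+
  show "a *\<^sub>R (x + y) = a *\<^sub>R x + a *\<^sub>R y" "(a + b) *\<^sub>R x = a *\<^sub>R x + b *\<^sub>R x"
    "a *\<^sub>R b *\<^sub>R x = (a * b) *\<^sub>R x" "1 *\<^sub>R x = x"
    by (transfer; simp add: fun_eq_iff scaleR_add_right scaleR_add_left)+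
  show "dist x y = norm (x - y)" by (rule dist_l2_def)
  show "sgn x = inverse (norm x) *\<^sub>R x" by (rule sgn_l2_def)
  show "(uniformity :: ('a l2 \<times> 'a l2) filter) = (INF e\<in>{0<..}. principal {(x, y). dist x y < e})"
    by (rule uniformity_l2_def)
  show "open U = (\<forall>x\<in>U. eventually (\<lambda>(x', y). x' = x \<longrightarrow> y \<in> U) uniformity)" for U :: "'a l2 set"
    by (rule open_l2_def)
  show "norm x = 0 \<longleftrightarrow> x = 0"
    by transfer (simp add: suminf_eq_zero_iff fun_eq_iff)
  show "norm (x + y) \<le> norm x + norm y"
  proof -
    have "(\<Sum>n<N. (norm (coord (x + y) n))\<^sup>2) \<le> (norm x + norm y)\<^sup>2" for N
    proof -
      have "L2_set (\<lambda>n. norm (coord (x + y) n)) {..<N}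
          \<le> L2_set (\<lambda>n. norm (coord x n) + norm (coord y n)) {..<N}"
        by (rule L2_set_mono) (simp_all add: plus_l2.rep_eq norm_triangle_ineq)
      also have "\<dots> \<le> L2_set (\<lambda>n. norm (coord x n)) {..<N} + L2_set (\<lambda>n. norm (coord y n)) {..<N}"
        by (rule L2_set_triangle_ineq)
      also have "\<dots> \<le> norm x + norm y"
        by (intro add_mono L2_set_le_norm_l2)
      finally show ?thesis
        unfolding L2_set_def by (rule sqrt_le_D)
    qed
    then have "(\<Sum>n. (norm (coord (x + y) n))\<^sup>2) \<le> (norm x + norm y)\<^sup>2"
      by (intro suminf_le_const summable_coord)
    then show ?thesis
      unfolding norm_l2.rep_eq [of "x + y"]
      by (intro real_le_lsqrt add_nonneg_nonneg norm_l2_nonneg)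
  qed
  show "norm (a *\<^sub>R x) = \<bar>a\<bar> * norm x"
    by transfer (simp add: power_mult_distrib suminf_mult real_sqrt_mult)
qed

end

definition inner_l2 :: "'a::real_or_complex l2 \<Rightarrow> 'a l2 \<Rightarrow> 'a" where
  "inner_l2 x y = (\<Sum>n. coord x n * conjugate (coord y n))"

definition nonneg_l2 :: "'a::real_or_complex l2 \<Rightarrow> bool" where
  "nonneg_l2 x \<longleftrightarrow> (\<forall>n. nonneg_scalar (coord x n))"

text \<open>\<open>bounded_linear\<close> only gives linearity over the reals.\<close>

definition bounded_operator :: "('a::real_or_complex l2 \<Rightarrow> 'a l2) \<Rightarrow> bool" where
  "bounded_operator T \<longleftrightarrow>
     bounded_linear T \<and> (\<forall>c x. T (scale_l2 c x) = scale_l2 c (T x))"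

definition entry :: "('a::real_or_complex l2 \<Rightarrow> 'a l2) \<Rightarrow> nat \<Rightarrow> nat \<Rightarrow> 'a" where
  "entry T i j = coord (T (unit_l2 j)) i"

definition adjoint_op :: "('a::real_or_complex l2 \<Rightarrow> 'a l2) \<Rightarrow> 'a l2 \<Rightarrow> 'a l2" where
  "adjoint_op T = (THE T'. bounded_operator T' \<and>
     (\<forall>x y. inner_l2 (T x) y = inner_l2 x (T' y)))"

definition lattice_positive :: "('a::real_or_complex l2 \<Rightarrow> 'a l2) \<Rightarrow> bool" where
  "lattice_positive T \<longleftrightarrow> bounded_operator T \<and> (\<forall>x. nonneg_l2 x \<longrightarrow> nonneg_l2 (T x))"

definition pos_semidefinite :: "('a::real_or_complex l2 \<Rightarrow> 'a l2) \<Rightarrow> bool" where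
  "pos_semidefinite T \<longleftrightarrow> bounded_operator T \<and> adjoint_op T = T \<and>
     (\<forall>x. nonneg_scalar (inner_l2 (T x) x))"

definition projection :: "('a::real_or_complex l2 \<Rightarrow> 'a l2) \<Rightarrow> bool" where
  "projection P \<longleftrightarrow> bounded_operator P \<and> adjoint_op P = P \<and> P \<circ> P = P"

text \<open>
  The operator \<open>A\<close> below is the modulus \<open>|T| = (T\<^sup>*T)\<^bsup>1/2\<^esup>\<close>, the unique positive semidefinite
  square root of \<open>T\<^sup>*T\<close>; the diagonal entries of \<open>A\<close> are nonnegative, so that summability of the
  diagonal means that \<open>|T|\<close> has finite trace.
\<close>

definition trace_class :: "('a::real_or_complex l2 \<Rightarrow> 'a l2) \<Rightarrow> bool" where
  "trace_class T \<longleftrightarrow> bounded_operator T \<and>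
     (\<exists>A. pos_semidefinite A \<and> A \<circ> A = adjoint_op T \<circ> T \<and> summable (\<lambda>n. entry A n n))"

definition trace_op :: "('a::real_or_complex l2 \<Rightarrow> 'a l2) \<Rightarrow> 'a" where
  "trace_op T = (\<Sum>n. entry T n n)"

definition op_semigroup :: "('a::real_or_complex l2 \<Rightarrow> 'a l2) set \<Rightarrow> bool" where
  "op_semigroup \<S> \<longleftrightarrow> (\<forall>S\<in>\<S>. \<forall>T\<in>\<S>. S \<circ> T \<in> \<S>)"

definition self_adjoint_collection :: "('a::real_or_complex l2 \<Rightarrow> 'a l2) set \<Rightarrow> bool" where
  "self_adjoint_collection \<C> \<longleftrightarrow> (\<forall>T\<in>\<C>. adjoint_op T \<in> \<C>)"

definition psd_part :: "('a::real_or_complex l2 \<Rightarrow> 'a l2) set \<Rightarrow> ('a l2 \<Rightarrow> 'a l2) set" where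
  "psd_part \<S> = {S \<in> \<S>. pos_semidefinite S}"

end

theory Submission
  imports Defs
begin

text \<open>
  Let \<open>T = SS\<^sup>*\<close>. Since \<open>\<langle>T\<^bsup>2n\<^esup>x, x\<rangle> = \<parallel>T\<^sup>nx\<parallel>\<^sup>2\<close>, the even powers of \<open>T\<close> are positive semidefinite
  members of the semigroup, and the sequence \<open>n \<mapsto> \<parallel>T\<^sup>nx\<parallel>\<^sup>2\<close> is convex, with second differences
  \<open>\<parallel>T\<^sup>n(x - T\<^sup>2x)\<parallel>\<^sup>2\<close>. A convex sequence with finitely many values has a vanishing second
  difference. In case (ii) this is applied with \<open>x = e\<^sub>i\<close>, in case (i) to the sums over all \<open>i\<close>;
  either way \<open>T = T\<^sup>3\<close>, and then \<open>T = T\<^sup>2\<close> because \<open>1 + T\<close> is injective.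

  So \<open>SS\<^sup>*\<close> and \<open>S\<^sup>*S\<close> are projections with nonnegative entries. A nonnegative vector \<open>y\<close> in the range
  of \<open>SS\<^sup>*\<close> splits as \<open>cp + x\<close>, where \<open>p = SS\<^sup>*e\<^sub>i\<close>, \<open>x \<ge> 0\<close> and \<open>x\<close> is orthogonal to \<open>p\<close>. For
  \<open>y = Se\<^sub>j\<close> with a nonzero \<open>i\<close>-th entry, positivity of \<open>S\<^sup>*\<close> forces \<open>x = 0\<close>, hence \<open>Se\<^sub>j = c SS\<^sup>*e\<^sub>i\<close>.
  Comparing the \<open>i\<close>-th entries and the norms of both sides gives
  \<open>S\<^bsub>ij\<^esub>\<^sup>2 = (SS\<^sup>*)\<^bsub>ii\<^esub> (S\<^sup>*S)\<^bsub>jj\<^esub>\<close>.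
\<close>

subsection \<open>Scalars\<close>

lemma conjugate_0 [simp]: "conjugate (0::'a::real_or_complex) = 0"
  using conjugate_add [of "0::'a" 0] by simp

text \<open>Cancelling \<open>of_real r\<close> in \<open>mult_conjugate\<close> gives this;
  together with \<open>conjugate_mult\<close> it makes conjugation real-linear.\<close>

lemma conjugate_of_real [simp]: "conjugate (of_real r :: 'a::real_or_complex) = of_real r"
proof (cases "r = 0")
  case False
  have "of_real r * conjugate (of_real r :: 'a) = of_real r * of_real r"
    using mult_conjugate [of "of_real r :: 'a"]
    by (simp add: scaleR_conv_of_real abs_mult_self_eq flip: of_real_mult)
  with False show ?thesis
    by simp
qed simp

lemma norm_conjugate [simp]: "norm (conjugate (a::'a::real_or_complex)) = norm a"
proof (cases "a = 0")
  case False
  have "norm a * norm (conjugate a) = norm a * norm a"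
    using arg_cong [OF mult_conjugate [of a], of norm] by (simp add: norm_mult)
  with False show ?thesis
    by simp
qed simp

lemma conjugate_scaleR: "conjugate (r *\<^sub>R a) = r *\<^sub>R conjugate (a::'a::real_or_complex)"
  by (simp add: scaleR_conv_of_real conjugate_mult)

lemma bounded_linear_conjugate: "bounded_linear (conjugate :: 'a::real_or_complex \<Rightarrow> 'a)"
  by (rule bounded_linear_intro [of _ 1]) (simp_all add: conjugate_add conjugate_scaleR)

lemma mult_conjugate_of_real: "a * conjugate a = of_real ((norm (a::'a::real_or_complex))\<^sup>2)"
  by (simp add: mult_conjugate scaleR_conv_of_real power2_eq_square)

lemma nonneg_scalar_iff: "nonneg_scalar a \<longleftrightarrow> a = of_real (norm a)"
  unfolding nonneg_scalar_def by (metis abs_of_nonneg norm_ge_zero norm_of_real)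

lemma nonneg_scalar_of_real [simp]: "nonneg_scalar (of_real r :: 'a::real_or_complex) \<longleftrightarrow> 0 \<le> r"
  unfolding nonneg_scalar_def by auto

lemma nonneg_scalarE:
  assumes "nonneg_scalar (a::'a::real_or_complex)"
  obtains r where "0 \<le> r" "a = of_real r"
  using assms unfolding nonneg_scalar_def by blast

subsection \<open>The inner product of \<open>l2\<close>\<close>

lemmas coord_simps [simp] =
  zero_l2.rep_eq plus_l2.rep_eq minus_l2.rep_eq uminus_l2.rep_eq scaleR_l2.rep_eq scale_l2.rep_eq

lemma l2_eqI: "(\<And>n. coord x n = coord y n) \<Longrightarrow> x = y"
  using coord_inject [of x y] by blast

lemma coord_sum: "coord (\<Sum>a\<in>A. f a) n = (\<Sum>a\<in>A. coord (f a) n)"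
  by (induction A rule: infinite_finite_induct) simp_all

lemma coord_unit [simp]: "coord (unit_l2 i) n = (if n = i then 1 else 0)"
  by (simp add: unit_l2.rep_eq)

lemma norm_l2_squared: "(norm (x :: 'a::real_or_complex l2))\<^sup>2 = (\<Sum>n. (norm (coord x n))\<^sup>2)"
  unfolding norm_l2.rep_eq by (simp add: suminf_nonneg summable_coord)

lemma summable_norm_mult_l2:
  fixes x y :: "'a::real_or_complex l2"
  shows "summable (\<lambda>n. norm (coord x n) * norm (coord y n))"
proof (rule summable_comparison_test')
  show "summable (\<lambda>n. (norm (coord x n))\<^sup>2 + (norm (coord y n))\<^sup>2)"
    by (intro summable_add summable_coord)
  fix n
  have "0 \<le> norm (coord x n) * norm (coord y n)"
    by simp
  then show "norm (norm (coord x n) * norm (coord y n)) \<le> (norm (coord x n))\<^sup>2 + (norm (coord y n))\<^sup>2"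
    using sum_squares_bound [of "norm (coord x n)" "norm (coord y n)"]
    by (simp only: real_norm_def abs_of_nonneg)
qed

lemma summable_inner_l2:
  fixes x y :: "'a::real_or_complex l2"
  shows "summable (\<lambda>n. coord x n * conjugate (coord y n))"
  by (rule summable_norm_cancel) (simp add: norm_mult summable_norm_mult_l2)

lemma norm_inner_l2_le:
  fixes x y :: "'a::real_or_complex l2"
  shows "norm (inner_l2 x y) \<le> norm x * norm y"
proof -
  have "norm (inner_l2 x y) \<le> (\<Sum>n. norm (coord x n) * norm (coord y n))"
    unfolding inner_l2_def
    using summable_norm [of "\<lambda>n. coord x n * conjugate (coord y n)"] summable_norm_mult_l2 [of x y]
    by (simp add: norm_mult)
  also have "\<dots> \<le> norm x * norm y"
  proof (rule suminf_le_const [OF summable_norm_mult_l2])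
    fix N
    have "(\<Sum>n<N. norm (coord x n) * norm (coord y n))
        \<le> L2_set (\<lambda>n. norm (coord x n)) {..<N} * L2_set (\<lambda>n. norm (coord y n)) {..<N}"
      using L2_set_mult_ineq [of "\<lambda>n. norm (coord x n)" "\<lambda>n. norm (coord y n)" "{..<N}"] by simp
    also have "\<dots> \<le> norm x * norm y"
      by (intro mult_mono L2_set_le_norm_l2 L2_set_nonneg norm_l2_nonneg)
    finally show "(\<Sum>n<N. norm (coord x n) * norm (coord y n)) \<le> norm x * norm y" .
  qed
  finally show ?thesis .
qed

lemma inner_l2_commute: "inner_l2 y x = conjugate (inner_l2 x y)"
  unfolding inner_l2_def bounded_linear.suminf [OF bounded_linear_conjugate summable_inner_l2]
  by (simp add: conjugate_mult conjugate_conjugate mult.commute)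

lemma inner_l2_add_left: "inner_l2 (x + y) z = inner_l2 x z + inner_l2 y z"
  unfolding inner_l2_def by (simp add: distrib_right suminf_add summable_inner_l2)

lemma inner_l2_scale_left: "inner_l2 (scale_l2 c x) z = c * inner_l2 x z"
  unfolding inner_l2_def by (simp add: mult.assoc suminf_mult summable_inner_l2)

lemma scaleR_eq_scale_l2: "r *\<^sub>R x = scale_l2 (of_real r) x"
  by (rule l2_eqI) (simp add: scaleR_conv_of_real)

lemma inner_l2_scaleR_left: "inner_l2 (r *\<^sub>R x) z = of_real r * inner_l2 x z"
  by (simp only: scaleR_eq_scale_l2 inner_l2_scale_left)

lemma inner_l2_diff_left: "inner_l2 (x - y) z = inner_l2 x z - inner_l2 y z"
  using inner_l2_add_left [of "x - y" y z] by (simp add: eq_diff_eq)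

lemma inner_l2_add_right: "inner_l2 z (x + y) = inner_l2 z x + inner_l2 z y"
  by (subst (1 2 3) inner_l2_commute) (simp add: inner_l2_add_left conjugate_add)

lemma inner_l2_diff_right: "inner_l2 z (x - y) = inner_l2 z x - inner_l2 z y"
  using inner_l2_add_right [of z "x - y" y] by (simp add: eq_diff_eq)

lemma inner_l2_scale_right: "inner_l2 z (scale_l2 c x) = conjugate c * inner_l2 z x"
  by (subst (1 2) inner_l2_commute) (simp add: inner_l2_scale_left conjugate_mult)

lemma inner_l2_scaleR_right: "inner_l2 z (r *\<^sub>R x) = of_real r * inner_l2 z x"
  by (simp add: scaleR_eq_scale_l2 inner_l2_scale_right)

lemma inner_l2_zero_left [simp]: "inner_l2 0 z = 0"
  by (simp add: inner_l2_def)

lemma inner_l2_zero_right [simp]: "inner_l2 z 0 = 0"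
  by (simp add: inner_l2_def)

lemma inner_l2_sum_right: "inner_l2 z (\<Sum>a\<in>A. f a) = (\<Sum>a\<in>A. inner_l2 z (f a))"
  by (induction A rule: infinite_finite_induct) (simp_all add: inner_l2_add_right)

lemma inner_l2_same: "inner_l2 x x = of_real ((norm x)\<^sup>2)"
  unfolding inner_l2_def mult_conjugate_of_real norm_l2_squared
  by (rule suminf_of_real [OF summable_coord, symmetric])

lemma inner_l2_unit_right [simp]: "inner_l2 x (unit_l2 i) = coord x i"
  unfolding inner_l2_def using conjugate_of_real [of 1, where 'a='a]
  by (subst suminf_finite [of "{i}"]) auto

lemma inner_l2_eqI: "(\<And>z. inner_l2 z x = inner_l2 z y) \<Longrightarrow> x = y"
  by (metis inner_l2_commute inner_l2_unit_right l2_eqI)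

lemma norm_diff_squared_l2:
  "of_real ((norm (x - y))\<^sup>2) =
    of_real ((norm x)\<^sup>2) - inner_l2 x y - inner_l2 y x + (of_real ((norm y)\<^sup>2) :: 'a::real_or_complex)"
  by (simp only: inner_l2_diff_left inner_l2_diff_right algebra_simps flip: inner_l2_same)

text \<open>The squared distance is the tail of a convergent series. Continuity then carries
  identities from the unit vectors to all of \<open>l2\<close>.\<close>

lemma finite_sections_tendsto:
  fixes x :: "'a::real_or_complex l2"
  shows "(\<lambda>N. \<Sum>n<N. scale_l2 (coord x n) (unit_l2 n)) \<longlonglongrightarrow> x"
proof -
  let ?u = "\<lambda>N. \<Sum>n<N. scale_l2 (coord x n) (unit_l2 n)"
  let ?f = "\<lambda>n. (norm (coord x n))\<^sup>2"
  have "(norm (?u N - x))\<^sup>2 = (\<Sum>n. ?f n) - (\<Sum>n<N. ?f n)" for N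
  proof -
    have "coord (?u N) n = (if n < N then coord x n else 0)" for n
      by (simp add: coord_sum if_distrib cong: if_cong)
    then have "(norm (coord (?u N - x) n))\<^sup>2 = ?f n - (if n < N then ?f n else 0)" for n
      by simp
    moreover have "(\<lambda>n. ?f n - (if n < N then ?f n else 0)) sums ((\<Sum>n. ?f n) - (\<Sum>n<N. ?f n))"
      using sums_If_finite_set [of "{..<N}" ?f]
      by (intro sums_diff summable_sums summable_coord) simp
    ultimately show ?thesis
      unfolding norm_l2_squared by (simp add: sums_iff)
  qed
  moreover have "(\<lambda>N. (\<Sum>n. ?f n) - (\<Sum>n<N. ?f n)) \<longlonglongrightarrow> (\<Sum>n. ?f n) - (\<Sum>n. ?f n)"
    by (intro tendsto_intros summable_LIMSEQ summable_coord)
  ultimately have "(\<lambda>N. (norm (?u N - x))\<^sup>2) \<longlonglongrightarrow> 0"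
    by simp
  then have "(\<lambda>N. sqrt ((norm (?u N - x))\<^sup>2)) \<longlonglongrightarrow> sqrt 0"
    by (rule tendsto_real_sqrt)
  then have "(\<lambda>N. norm (?u N - x)) \<longlonglongrightarrow> 0"
    by simp
  then show ?thesis
    by (rule LIM_zero_cancel [OF tendsto_norm_zero_cancel])
qed

subsection \<open>Adjoints\<close>

lemma bounded_operatorD:
  assumes "bounded_operator T"
  shows "bounded_linear T" "T (scale_l2 c x) = scale_l2 c (T x)" "T (x + y) = T x + T y"
    "T (x - y) = T x - T y" "T (r *\<^sub>R x) = r *\<^sub>R T x" "T 0 = 0"
    "T (\<Sum>a\<in>A. f a) = (\<Sum>a\<in>A. T (f a))"
  using assms unfolding bounded_operator_def
  by (auto simp: linear_simps bounded_linear.linear linear_sum)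

lemma bounded_operator_comp:
  assumes "bounded_operator T" "bounded_operator U"
  shows "bounded_operator (T \<circ> U)"
  using assms unfolding bounded_operator_def comp_def
  by (auto intro: bounded_linear_compose)

text \<open>The Riesz vector is built by coordinates. Testing \<open>T\<close> on truncations of the
  candidate shows square-summability; the identity then extends along finite sections.\<close>

lemma adjoint_vector_exists:
  fixes T :: "'a::real_or_complex l2 \<Rightarrow> 'a l2"
  assumes T: "bounded_operator T"
  shows "\<exists>z. \<forall>x. inner_l2 (T x) y = inner_l2 x z"
proof -
  note D = bounded_operatorD [OF T]
  obtain K where K: "0 \<le> K" "\<And>x. norm (T x) \<le> norm x * K"
    using bounded_linear.nonneg_bounded [OF D(1)] by blast
  \<comment> \<open>Forced: the \<open>n\<close>-th coordinate of \<open>z\<close> must be the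
    conjugate of \<open>inner_l2 (T (unit_l2 n)) y\<close>.\<close>
  define b where "b n = inner_l2 y (T (unit_l2 n))" for n
  have "(\<Sum>n<N. (norm (b n))\<^sup>2) \<le> (norm y * K)\<^sup>2" for N
  proof -
    \<comment> \<open>For this truncation, \<open>inner_l2 y (T u)\<close> is the squared norm of
      \<open>u\<close>, so Cauchy-Schwarz and cancelling \<open>norm u\<close> bound it uniformly in
      \<open>N\<close>.\<close>
    define u where "u = (\<Sum>n<N. scale_l2 (b n) (unit_l2 n))"
    have "coord u n = (if n < N then b n else 0)" for n
      by (simp add: u_def coord_sum if_distrib cong: if_cong)
    then have u: "(norm u)\<^sup>2 = (\<Sum>n<N. (norm (b n))\<^sup>2)"
      unfolding norm_l2_squared by (subst suminf_finite [of "{..<N}"]) auto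
    have "inner_l2 y (T u) = (\<Sum>n<N. of_real ((norm (b n))\<^sup>2))"
      unfolding u_def D(7) D(2) inner_l2_sum_right inner_l2_scale_right
      by (simp add: mult.commute mult_conjugate_of_real flip: b_def)
    also have "\<dots> = of_real ((norm u)\<^sup>2)"
      by (simp add: u)
    finally have "(norm u)\<^sup>2 \<le> norm y * norm (T u)"
      using norm_inner_l2_le [of y "T u"] by (metis abs_of_nonneg norm_of_real zero_le_power2)
    also have "\<dots> \<le> norm y * (norm u * K)"
      by (intro mult_left_mono K) simp
    finally have "norm u * norm u \<le> norm u * (norm y * K)"
      by (simp add: power2_eq_square mult_ac)
    then have "norm u \<le> norm y * K"
      using K(1) by (cases "u = 0") auto
    then show ?thesis
      unfolding u [symmetric] by (simp add: power_mono)
  qed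
  then have sb: "summable (\<lambda>n. (norm (b n))\<^sup>2)"
    by (intro bounded_imp_summable [of _ "(norm y * K)\<^sup>2"]) (simp_all only: zero_le_power2 flip: lessThan_Suc_atMost)
  define z where "z = Abs_l2 b"
  have cz: "coord z = b"
    using sb by (simp add: z_def Abs_l2_inverse)
  have "inner_l2 (T x) y = inner_l2 x z" for x
  proof -
    let ?u = "\<lambda>N. \<Sum>n<N. scale_l2 (coord x n) (unit_l2 n)"
    have "norm (inner_l2 (T v) y) \<le> norm v * (K * norm y)" for v
      using norm_inner_l2_le [of "T v" y] mult_right_mono [OF K(2) [of v] norm_ge_zero [of y]]
      by (simp add: mult.assoc)
    then have bl: "bounded_linear (\<lambda>v. inner_l2 (T v) y)"
      by (intro bounded_linear_intro [of _ "K * norm y"])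
        (simp_all add: D(3,5) inner_l2_add_left inner_l2_scaleR_left scaleR_conv_of_real)
    have "(\<lambda>N. inner_l2 (T (?u N)) y) \<longlonglongrightarrow> inner_l2 (T x) y"
      by (rule bounded_linear.tendsto [OF bl finite_sections_tendsto])
    moreover have "inner_l2 (T (?u N)) y = (\<Sum>n<N. coord x n * conjugate (coord z n))" for N
    proof -
      have "inner_l2 (T (?u N)) y = conjugate (inner_l2 y (T (?u N)))"
        by (rule inner_l2_commute)
      also have "\<dots> = conjugate (\<Sum>n<N. conjugate (coord x n) * coord z n)"
        unfolding D(7) D(2) inner_l2_sum_right inner_l2_scale_right cz b_def ..
      also have "\<dots> = (\<Sum>n<N. coord x n * conjugate (coord z n))"
        by (simp add: linear_sum [OF bounded_linear.linear [OF bounded_linear_conjugate]]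
            conjugate_mult conjugate_conjugate)
      finally show ?thesis .
    qed
    ultimately have "(\<lambda>n. coord x n * conjugate (coord z n)) sums inner_l2 (T x) y"
      by (simp add: sums_def)
    then show ?thesis
      by (simp add: inner_l2_def sums_iff)
  qed
  then show ?thesis
    by blast
qed

text \<open>Linearity follows by pairing with arbitrary vectors, the bound from Cauchy-Schwarz for
  \<open>inner_l2 (T (T' x)) x\<close>, which is the squared norm of \<open>T' x\<close>.\<close>

lemma bounded_operator_adjointI:
  assumes T: "bounded_operator T" and T': "\<And>x y. inner_l2 (T x) y = inner_l2 x (T' y)"
  shows "bounded_operator T'"
proof -
  note D = bounded_operatorD [OF T]
  obtain K where K: "0 \<le> K" "\<And>x. norm (T x) \<le> norm x * K"
    using bounded_linear.nonneg_bounded [OF D(1)] by blast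
  have add: "T' (x + y) = T' x + T' y" for x y
    by (rule inner_l2_eqI) (simp add: inner_l2_add_right flip: T')
  have scale: "T' (scale_l2 c x) = scale_l2 c (T' x)" for c x
    by (rule inner_l2_eqI) (simp add: inner_l2_scale_right flip: T')
  have "norm (T' x) \<le> norm x * K" for x
  proof -
    have "of_real ((norm (T' x))\<^sup>2) = inner_l2 (T (T' x)) x"
      by (simp only: T' inner_l2_same)
    then have "(norm (T' x))\<^sup>2 \<le> norm (T (T' x)) * norm x"
      using norm_inner_l2_le [of "T (T' x)" x] by (metis abs_of_nonneg norm_of_real zero_le_power2)
    also have "\<dots> \<le> norm (T' x) * K * norm x"
      by (intro mult_right_mono K) simp
    finally have "norm (T' x) * norm (T' x) \<le> norm (T' x) * (norm x * K)"
      by (simp add: power2_eq_square mult_ac)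
    then show ?thesis
      using K(1) by (cases "T' x = 0") auto
  qed
  then have "bounded_linear T'"
    by (intro bounded_linear_intro [of _ K]) (auto simp: add scale scaleR_eq_scale_l2)
  with scale show ?thesis
    by (simp add: bounded_operator_def)
qed

text \<open>Access to the definite description: inner products determine a vector, so the adjoint
  identity pins \<open>T'\<close> down.\<close>

lemma adjoint_op_eqI:
  assumes T: "bounded_operator T" and T': "\<And>x y. inner_l2 (T x) y = inner_l2 x (T' y)"
  shows "adjoint_op T = T'"
  unfolding adjoint_op_def
proof (rule the_equality)
  show "bounded_operator T' \<and> (\<forall>x y. inner_l2 (T x) y = inner_l2 x (T' y))"
    using bounded_operator_adjointI [OF T T'] T' by blast
  fix U
  assume "bounded_operator U \<and> (\<forall>x y. inner_l2 (T x) y = inner_l2 x (U y))"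
  then show "U = T'"
    using T' by (metis ext inner_l2_eqI)
qed

lemma adjoint_op:
  assumes "bounded_operator T"
  shows "inner_l2 (T x) y = inner_l2 x (adjoint_op T y)"
proof -
  obtain T' where "\<And>x y. inner_l2 (T x) y = inner_l2 x (T' y)"
    using adjoint_vector_exists [OF assms] by metis
  with adjoint_op_eqI [OF assms this] show ?thesis
    by simp
qed

lemma adjoint_op':
  assumes "bounded_operator T"
  shows "inner_l2 (adjoint_op T x) y = inner_l2 x (T y)"
  using adjoint_op [OF assms] by (metis inner_l2_commute)

lemma bounded_operator_adjoint: "bounded_operator T \<Longrightarrow> bounded_operator (adjoint_op T)"
  using bounded_operator_adjointI adjoint_op by blast

lemma adjoint_adjoint: "bounded_operator T \<Longrightarrow> adjoint_op (adjoint_op T) = T"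
  by (rule adjoint_op_eqI [OF bounded_operator_adjoint adjoint_op'])

lemma adjoint_op_comp_self:
  assumes T: "bounded_operator T"
  shows "adjoint_op (T \<circ> adjoint_op T) = T \<circ> adjoint_op T"
  by (rule adjoint_op_eqI)
    (simp_all add: bounded_operator_comp bounded_operator_adjoint T adjoint_op [OF T] flip: adjoint_op' [OF T])

subsection \<open>Idempotency of \<open>SS\<^sup>*\<close>\<close>

lemma pos_semidefinite_norm_bound:
  fixes A :: "'a::real_or_complex l2 \<Rightarrow> 'a l2"
  assumes A: "pos_semidefinite A"
  obtains K where "\<And>x. (norm (A x))\<^sup>2 \<le> K * norm (inner_l2 (A x) x)"
proof -
  have bA: "bounded_operator A" and sA: "\<And>x y. inner_l2 (A x) y = inner_l2 x (A y)"
    and pA: "\<And>x. nonneg_scalar (inner_l2 (A x) x)"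
    using A adjoint_op [of A] unfolding pos_semidefinite_def by auto
  obtain K where K: "0 < K" "\<And>x. norm (A x) \<le> norm x * K"
    using bounded_linear.pos_bounded [OF bounded_operatorD(1) [OF bA]] by blast
  have "(norm (A x))\<^sup>2 \<le> K * norm (inner_l2 (A x) x)" for x
  proof -
    obtain a b where a: "0 \<le> a" "inner_l2 (A x) x = of_real a"
      and b: "0 \<le> b" "inner_l2 (A (A x)) (A x) = of_real b"
      using pA nonneg_scalarE by metis
    have "b \<le> norm (A (A x)) * norm (A x)"
      using norm_inner_l2_le [of "A (A x)" "A x"] b by simp
    also have "\<dots> \<le> norm (A x) * K * norm (A x)"
      by (intro mult_right_mono K) simp
    finally have b_le: "b \<le> K * (norm (A x))\<^sup>2"
      by (simp add: power2_eq_square mult_ac)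
    \<comment> \<open>Given \<open>b_le\<close>, the step \<open>t = 1 / K\<close> makes the upper
      bound for the quadratic form at \<open>x - t *\<^sub>R A x\<close> smallest.\<close>
    define y where "y = x - (1 / K) *\<^sub>R A x"
    have "inner_l2 (A y) y = of_real (a - 2 / K * (norm (A x))\<^sup>2 + b / K\<^sup>2)"
      unfolding y_def bounded_operatorD(4,5) [OF bA] inner_l2_diff_left inner_l2_diff_right
        inner_l2_scaleR_left inner_l2_scaleR_right sA [of "A x" x] inner_l2_same a b
      using K(1) by (simp add: field_simps power2_eq_square)
    then have "0 \<le> a - 2 / K * (norm (A x))\<^sup>2 + b / K\<^sup>2"
      using pA [of y] by (simp only: nonneg_scalar_of_real)
    also have "\<dots> \<le> a - 2 / K * (norm (A x))\<^sup>2 + (norm (A x))\<^sup>2 / K"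
      using b_le K(1) by (simp add: field_simps power2_eq_square)
    finally show ?thesis
      using K(1) a by (simp add: field_simps)
  qed
  then show thesis
    using that by blast
qed

text \<open>\<open>T x\<close> and \<open>A x\<close> have equal norms, and the squared norm of
  \<open>A (unit_l2 n)\<close> is at most a constant times the \<open>n\<close>-th diagonal entry of
  \<open>A\<close>.\<close>

lemma trace_class_imp_Hilbert_Schmidt:
  fixes T :: "'a::real_or_complex l2 \<Rightarrow> 'a l2"
  assumes "trace_class T"
  shows "summable (\<lambda>n. (norm (T (unit_l2 n)))\<^sup>2)"
proof -
  obtain A where bT: "bounded_operator T" and A: "pos_semidefinite A"
    and AA: "A \<circ> A = adjoint_op T \<circ> T" and sm: "summable (\<lambda>n. entry A n n)"
    using assms unfolding trace_class_def by blast
  have sA: "inner_l2 (A x) y = inner_l2 x (A y)" for x y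
    using A adjoint_op [of A] unfolding pos_semidefinite_def by auto
  obtain K where K: "\<And>x. (norm (A x))\<^sup>2 \<le> K * norm (inner_l2 (A x) x)"
    using pos_semidefinite_norm_bound [OF A] by blast
  have "(of_real ((norm (T x))\<^sup>2) :: 'a) = of_real ((norm (A x))\<^sup>2)" for x
    using fun_cong [OF AA, of x] unfolding inner_l2_same [symmetric]
    by (simp add: adjoint_op [OF bT] sA)
  then have TA: "(norm (T x))\<^sup>2 = (norm (A x))\<^sup>2" for x
    by (simp only: of_real_eq_iff)
  have e: "entry A n n = inner_l2 (A (unit_l2 n)) (unit_l2 n)" for n
    by (simp add: entry_def)
  then have "entry A n n = of_real (norm (entry A n n))" for n
    using A unfolding pos_semidefinite_def by (simp only: nonneg_scalar_iff)
  then have "summable (\<lambda>n. of_real (norm (entry A n n)) :: 'a)"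
    using sm by simp
  \<comment> \<open>The Cauchy criterion moves summability from \<open>'a\<close> to the reals, as
    \<open>of_real\<close> preserves norms.\<close>
  then have "summable (\<lambda>n. norm (entry A n n))"
    unfolding summable_Cauchy by (simp flip: of_real_sum)
  then have "summable (\<lambda>n. K * norm (entry A n n))"
    by (rule summable_mult)
  then show ?thesis
    by (rule summable_comparison_test') (simp add: TA e K del: inner_l2_unit_right)
qed

text \<open>Otherwise the differences increase strictly. Either one is nonnegative and all later
  ones are positive, or all are negative; so \<open>f\<close> is injective on a tail.\<close>

lemma finite_range_convex_sequence:
  fixes f :: "nat \<Rightarrow> real"
  assumes fin: "finite (range f)" and conv: "\<And>n. 0 \<le> f n - 2 * f (Suc n) + f (Suc (Suc n))"
  shows "\<exists>n. f n - 2 * f (Suc n) + f (Suc (Suc n)) = 0"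
proof (rule ccontr)
  assume *: "\<nexists>n. f n - 2 * f (Suc n) + f (Suc (Suc n)) = 0"
  have d: "f (Suc n) - f n < f (Suc (Suc n)) - f (Suc n)" for n
    using conv [of n] * by (smt (verit))
  then have d_mono: "strict_mono (\<lambda>n. f (Suc n) - f n)"
    by (simp add: strict_mono_Suc_iff)
  have "\<exists>m. inj (\<lambda>n. f (m + n))"
  proof (cases "\<exists>m. 0 \<le> f (Suc m) - f m")
    case True
    then obtain m where m: "0 \<le> f (Suc m) - f m" ..
    \<comment> \<open>The difference at \<open>m\<close> may be zero, so strict growth is claimed
      only from \<open>Suc m\<close> on.\<close>
    have "f (Suc m + n) < f (Suc m + Suc n)" for n
      using strict_monoD [OF d_mono, of m "Suc m + n"] m by simp
    then have "strict_mono (\<lambda>n. f (Suc m + n))"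
      by (simp add: strict_mono_Suc_iff)
    then show ?thesis
      using strict_mono_imp_inj_on by blast
  next
    case False
    then have "strict_mono (\<lambda>n. - f n)"
      by (auto simp: strict_mono_Suc_iff not_le)
    then have "inj (\<lambda>n. - f n)"
      by (rule strict_mono_imp_inj_on)
    then have "inj (\<lambda>n. f (0 + n))"
      by (simp add: inj_def)
    then show ?thesis ..
  qed
  then obtain m where "inj (\<lambda>n. f (m + n))" ..
  then have "infinite (range (\<lambda>n. f (m + n)))"
    using finite_imageD by blast
  moreover have "range (\<lambda>n. f (m + n)) \<subseteq> range f"
    by auto
  ultimately show False
    using fin finite_subset by blast
qed

section \<open>Powers of a symmetric operator and idempotency\<close>

context
  fixes T :: "'a::real_or_complex l2 \<Rightarrow> 'a l2"
  assumes symmetric: "\<And>x y. inner_l2 (T x) y = inner_l2 x (T y)"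
    and bounded: "bounded_operator T"
begin

lemma bounded_operator_funpow: "bounded_operator (T ^^ n)"
proof (induction n)
  case 0
  show ?case by (simp add: bounded_operator_def id_def bounded_linear_ident)
next
  case (Suc n)
  then show ?case by (simp add: bounded_operator_comp bounded del: o_apply)
qed

lemma inner_l2_funpow: "inner_l2 ((T ^^ n) x) y = inner_l2 x ((T ^^ n) y)"
  by (induction n arbitrary: y) (simp_all add: symmetric flip: funpow_swap1)

text \<open>With \<open>u = (T ^^ n) x\<close> the vector is \<open>u - T (T u)\<close>, and by
  symmetry both cross terms equal the squared norm of \<open>T u\<close>.\<close>

lemma norm_funpow_diff:
  "(norm ((T ^^ n) (x - T (T x))))\<^sup>2 =
    (norm ((T ^^ n) x))\<^sup>2 - 2 * (norm ((T ^^ Suc n) x))\<^sup>2 + (norm ((T ^^ Suc (Suc n)) x))\<^sup>2"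
proof -
  have D: "(T ^^ n) (x - T (T x)) = (T ^^ n) x - T (T ((T ^^ n) x))"
    by (simp add: bounded_operatorD(4) [OF bounded_operator_funpow] funpow_swap1)
  have "inner_l2 ((T ^^ n) x) (T (T ((T ^^ n) x))) = of_real ((norm (T ((T ^^ n) x)))\<^sup>2)"
    "inner_l2 (T (T ((T ^^ n) x))) ((T ^^ n) x) = of_real ((norm (T ((T ^^ n) x)))\<^sup>2)"
    by (simp_all only: symmetric inner_l2_same flip: symmetric [of "(T ^^ n) x"])
  then have "(of_real ((norm ((T ^^ n) (x - T (T x))))\<^sup>2) :: 'a) = of_real (
    (norm ((T ^^ n) x))\<^sup>2 - 2 * (norm ((T ^^ Suc n) x))\<^sup>2 + (norm ((T ^^ Suc (Suc n)) x))\<^sup>2)"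
    unfolding D norm_diff_squared_l2 by simp
  then show ?thesis
    by (simp only: of_real_eq_iff)
qed

text \<open>By symmetry, the squared norm of \<open>(T ^^ Suc n) x\<close> is the inner product of
  \<open>(T ^^ n) x\<close> with \<open>(T ^^ Suc (Suc n)) x\<close>, so the exponent can be lowered
  step by step.\<close>

lemma funpow_eq_0_imp: "(T ^^ Suc n) x = 0 \<Longrightarrow> T x = 0"
proof (induction n)
  case (Suc n)
  have "of_real ((norm ((T ^^ Suc n) x))\<^sup>2) = inner_l2 ((T ^^ n) x) ((T ^^ Suc (Suc n)) x)"
    unfolding inner_l2_same [symmetric] by (simp add: symmetric)
  also have "\<dots> = 0"
    by (simp only: Suc.prems inner_l2_zero_right)
  finally have "(T ^^ Suc n) x = 0"
    by simp
  then show ?case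
    by (rule Suc.IH)
qed simp

end

text \<open>The defect \<open>z = T x - T (T x)\<close> satisfies \<open>T z = - z\<close>, while
  \<open>inner_l2 (T z) z\<close> is the squared norm of \<open>adjoint_op S z\<close>; the signs
  force \<open>z = 0\<close>.\<close>

lemma comp_adjoint_idempotent_onI:
  assumes S: "bounded_operator S" and T_def: "T = S \<circ> adjoint_op S"
    and x: "(T ^^ Suc n) (x - T (T x)) = 0"
  shows "T (T x) = T x"
proof -
  have bT: "bounded_operator T"
    unfolding T_def by (intro bounded_operator_comp bounded_operator_adjoint S)
  have sT: "inner_l2 (T y) z = inner_l2 y (T z)" for y z
    using adjoint_op [OF bT] adjoint_op_comp_self [OF S] by (simp add: T_def)
  define z where "z = T x - T (T x)"
  have "T (x - T (T x)) = 0"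
    by (rule funpow_eq_0_imp [OF sT bT x])
  then have "T z = - z"
    by (simp add: z_def bounded_operatorD(4) [OF bT])
  moreover have "inner_l2 (T z) z = of_real ((norm (adjoint_op S z))\<^sup>2)"
    by (simp only: T_def o_apply adjoint_op [OF S] inner_l2_same)
  moreover have "inner_l2 (- z) z = - of_real ((norm z)\<^sup>2)"
    using inner_l2_diff_left [of 0 z z] by (simp only: inner_l2_same inner_l2_zero_left diff_0)
  ultimately have "(of_real ((norm (adjoint_op S z))\<^sup>2) :: 'a) = of_real (- ((norm z)\<^sup>2))"
    by simp
  then have "(norm (adjoint_op S z))\<^sup>2 = - ((norm z)\<^sup>2)"
    by (simp only: of_real_eq_iff)
  then have "(norm z)\<^sup>2 \<le> 0"
    using zero_le_power2 [of "norm (adjoint_op S z)"] by linarith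
  then show ?thesis
    by (simp add: z_def)
qed

lemma comp_adjoint_projection:
  fixes \<S> :: "('a::real_or_complex l2 \<Rightarrow> 'a l2) set"
  assumes semi: "op_semigroup \<S>" and sa: "self_adjoint_collection \<S>"
    and bdd: "\<And>S. S \<in> \<S> \<Longrightarrow> bounded_operator S"
    and fin: "((\<forall>S\<in>\<S>. trace_class S) \<and> finite {trace_op S | S. S \<in> psd_part \<S>})
       \<or> (\<forall>i. finite {entry S i i | S. S \<in> psd_part \<S>})"
    and S: "S \<in> \<S>"
  shows "projection (S \<circ> adjoint_op S)"
proof -
  define T where "T = S \<circ> adjoint_op S"
  have TS: "T \<in> \<S>"
    using semi sa S unfolding T_def op_semigroup_def self_adjoint_collection_def by blast
  note bS = bdd [OF S] and bT = bdd [OF TS]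
  have aT: "adjoint_op T = T"
    unfolding T_def by (rule adjoint_op_comp_self [OF bS])
  then have sT: "inner_l2 (T y) z = inner_l2 y (T z)" for y z
    using adjoint_op [OF bT] by simp
  have pow: "T ^^ Suc n \<in> \<S>" for n
    using semi TS by (induction n) (auto simp: op_semigroup_def)
  \<comment> \<open>Exponents start at \<open>Suc n\<close> because the identity, the zeroth power,
    may lie outside the semigroup.\<close>
  define b where "b n i = (norm ((T ^^ Suc n) (unit_l2 i)))\<^sup>2" for n i
  have pow2: "inner_l2 ((T ^^ (Suc n + Suc n)) x) x = of_real ((norm ((T ^^ Suc n) x))\<^sup>2)" for n x
    by (simp only: funpow_add o_apply inner_l2_funpow [OF sT bT] inner_l2_same)
  have psd: "T ^^ (Suc n + Suc n) \<in> psd_part \<S>" for n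
  proof -
    have "adjoint_op (T ^^ (Suc n + Suc n)) = T ^^ (Suc n + Suc n)"
      by (intro adjoint_op_eqI bounded_operator_funpow inner_l2_funpow sT bT)
    moreover have "T ^^ (Suc n + Suc n) \<in> \<S>"
      using pow [of "n + Suc n"] by simp
    ultimately show ?thesis
      unfolding psd_part_def pos_semidefinite_def mem_Collect_eq pow2
      using bdd by (simp del: of_real_power)
  qed
  have entry_pow: "entry (T ^^ (Suc n + Suc n)) i i = of_real (b n i)" for n i
    using pow2 [of n "unit_l2 i"] by (simp only: inner_l2_unit_right entry_def b_def)
  have conv: "b n i - 2 * b (Suc n) i + b (Suc (Suc n)) i
      = (norm ((T ^^ Suc n) (unit_l2 i - T (T (unit_l2 i)))))\<^sup>2" for n i
    unfolding b_def by (rule norm_funpow_diff [OF sT bT, symmetric])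
  have "\<exists>n. b n i - 2 * b (Suc n) i + b (Suc (Suc n)) i = 0" for i
    using fin
  proof
    assume *: "\<forall>i. finite {entry S i i | S. S \<in> psd_part \<S>}"
    have "range (\<lambda>n. b n i) \<subseteq> norm ` {entry S i i | S. S \<in> psd_part \<S>}"
    proof clarify
      fix n
      have "b n i = norm (entry (T ^^ (Suc n + Suc n)) i i)"
        unfolding entry_pow norm_of_real by (simp add: b_def)
      then show "b n i \<in> norm ` {entry S i i | S. S \<in> psd_part \<S>}"
        using psd by blast
    qed
    then have "finite (range (\<lambda>n. b n i))"
      using * finite_surj by blast
    then show ?thesis
      by (rule finite_range_convex_sequence) (simp add: conv)
  next
    assume *: "(\<forall>S\<in>\<S>. trace_class S) \<and> finite {trace_op S | S. S \<in> psd_part \<S>}"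
    \<comment> \<open>Every positive power of \<open>T\<close> is in the semigroup, hence
      Hilbert-Schmidt.\<close>
    then have sm: "summable (b n)" for n
      unfolding b_def by (intro trace_class_imp_Hilbert_Schmidt) (use pow in blast)
    define t where "t n = (\<Sum>i. b n i)" for n
    have t: "t n - 2 * t (Suc n) + t (Suc (Suc n))
        = (\<Sum>i. b n i - 2 * b (Suc n) i + b (Suc (Suc n)) i)" for n
      unfolding t_def by (intro sums_unique sums_add sums_diff sums_mult summable_sums sm)
    have smc: "summable (\<lambda>i. b n i - 2 * b (Suc n) i + b (Suc (Suc n)) i)" for n
      by (intro summable_add summable_diff summable_mult sm)
    have "range t \<subseteq> norm ` {trace_op S | S. S \<in> psd_part \<S>}"
    proof clarify
      fix n
      have "trace_op (T ^^ (Suc n + Suc n)) = of_real (t n)"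
        unfolding trace_op_def entry_pow t_def by (rule suminf_of_real [OF sm, symmetric])
      moreover have "0 \<le> t n"
        unfolding t_def by (intro suminf_nonneg sm) (simp add: b_def)
      ultimately have "t n = norm (trace_op (T ^^ (Suc n + Suc n)))"
        by simp
      then show "t n \<in> norm ` {trace_op S | S. S \<in> psd_part \<S>}"
        using psd by blast
    qed
    then have "finite (range t)"
      using * finite_surj by blast
    then have "\<exists>n. t n - 2 * t (Suc n) + t (Suc (Suc n)) = 0"
      by (rule finite_range_convex_sequence) (unfold t, intro suminf_nonneg smc, simp add: conv)
    \<comment> \<open>A series of nonnegative terms with sum zero has only zero terms, so the
      \<open>n\<close> found for the traces serves every \<open>i\<close>.\<close>
    then show ?thesis
      unfolding t using suminf_eq_zero_iff [OF smc] by (auto simp: conv)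
  qed
  then have "\<exists>n. (T ^^ Suc n) (unit_l2 i - T (T (unit_l2 i))) = 0" for i
    unfolding conv power_eq_0_iff norm_eq_zero by blast
  then have unit: "T (T (unit_l2 i)) = T (unit_l2 i)" for i
    using comp_adjoint_idempotent_onI [OF bS T_def] by blast
  \<comment> \<open>Symmetry moves \<open>T\<close> onto the unit vectors, where idempotency is
    known.\<close>
  have "T (T x) = T x" for x
  proof (rule l2_eqI)
    fix i
    have "inner_l2 (T (T x)) (unit_l2 i) = inner_l2 (T x) (unit_l2 i)"
      by (simp only: sT unit)
    then show "coord (T (T x)) i = coord (T x) i"
      by simp
  qed
  with aT bT have "projection T"
    unfolding projection_def by (simp add: fun_eq_iff)
  then show ?thesis
    by (simp only: T_def)
qed

subsection \<open>Projections with nonnegative entries\<close>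

lemma lattice_positiveD:
  assumes "lattice_positive T"
  shows "bounded_operator T" "nonneg_l2 x \<Longrightarrow> nonneg_l2 (T x)"
  using assms unfolding lattice_positive_def by auto

lemma nonneg_l2_unit [simp]: "nonneg_l2 (unit_l2 i :: 'a::real_or_complex l2)"
  using nonneg_scalar_of_real [of 0, where 'a='a] nonneg_scalar_of_real [of 1, where 'a='a]
  by (simp add: nonneg_l2_def)

lemma nonneg_l2D: "nonneg_l2 x \<Longrightarrow> coord x n = of_real (norm (coord x n))"
  unfolding nonneg_l2_def nonneg_scalar_iff by blast

text \<open>The lattice order is expressed as nonnegativity of a difference; this reduces it to real
  inequalities.\<close>

lemma nonneg_l2_diff_iff:
  assumes x: "\<And>n. coord x n = (of_real (f n) :: 'a::real_or_complex)"
    and y: "\<And>n. coord y n = of_real (g n)"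
  shows "nonneg_l2 (x - y) \<longleftrightarrow> (\<forall>n. g n \<le> f n)"
  unfolding nonneg_l2_def minus_l2.rep_eq x y
  using nonneg_scalar_of_real [where 'a='a] by (metis diff_ge_0_iff_ge of_real_diff)

text \<open>The inner product is a series of nonnegative reals: orthogonal nonnegative vectors have
  disjoint supports.\<close>

lemma nonneg_inner_l2_eq_0:
  assumes x: "nonneg_l2 (x :: 'a::real_or_complex l2)" and y: "nonneg_l2 y" and "inner_l2 x y = 0"
  shows "coord x n = 0 \<or> coord y n = 0"
proof -
  let ?f = "\<lambda>n. norm (coord x n) * norm (coord y n)"
  have "coord x n * conjugate (coord y n) = of_real (?f n)" for n
    by (metis nonneg_l2D [OF x] nonneg_l2D [OF y] conjugate_of_real of_real_mult)
  then have "inner_l2 x y = of_real (\<Sum>n. ?f n)"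
    unfolding inner_l2_def by (simp only: suminf_of_real [OF summable_norm_mult_l2])
  then have "(\<Sum>n. ?f n) = 0"
    using assms by simp
  then show ?thesis
    using suminf_eq_zero_iff [OF summable_norm_mult_l2, of x y] by simp
qed

text \<open>
  With \<open>p\<close> a column of \<open>P\<close>, the vector \<open>w = min y (cp)\<close> satisfies \<open>Pw \<le> w\<close>, and \<open>w - Pw\<close> is
  orthogonal to \<open>p\<close>. So \<open>w\<close> and \<open>Pw\<close> agree at \<open>i\<close>, which makes \<open>cp - w\<close> orthogonal to \<open>p\<close>.
\<close>

lemma column_le_fixed_vector:
  fixes P :: "'a::real_or_complex l2 \<Rightarrow> 'a l2"
  assumes P: "projection P" "lattice_positive P" and y: "nonneg_l2 y" "P y = y"
    and pi: "coord (P (unit_l2 i)) i \<noteq> 0"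
  defines "c \<equiv> norm (coord y i) / norm (coord (P (unit_l2 i)) i)"
  shows "nonneg_l2 (y - c *\<^sub>R P (unit_l2 i))"
proof -
  note bP = lattice_positiveD(1) [OF P(2)] and pos = lattice_positiveD(2) [OF P(2)]
  have PP: "P (P x) = P x" for x
    using P(1) by (simp add: projection_def fun_eq_iff)
  have sP: "inner_l2 (P x) z = inner_l2 x (P z)" for x z
    using P(1) adjoint_op [OF bP] by (simp add: projection_def)
  define p where "p = P (unit_l2 i)"
  define q where "q = c *\<^sub>R p"
  have c: "0 \<le> c"
    by (simp add: c_def)
  have p: "nonneg_l2 p"
    unfolding p_def by (rule pos [OF nonneg_l2_unit])
  have qn: "coord q n = of_real (c * norm (coord p n))" for n
    unfolding q_def scaleR_l2.rep_eq scaleR_conv_of_real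
    using nonneg_l2D [OF p, of n] by (metis of_real_mult)
  note yn = nonneg_l2D [OF y(1)]
  define m where "m n = min (norm (coord y n)) (c * norm (coord p n))" for n
  define w :: "'a l2" where "w = Abs_l2 (\<lambda>n. of_real (m n))"
  have "summable (\<lambda>n. (norm (of_real (m n) :: 'a))\<^sup>2)"
    by (rule summable_comparison_test' [OF summable_coord [of y]])
      (auto simp: m_def c intro!: power_mono)
  then have wn: "coord w n = of_real (m n)" for n
    by (simp add: w_def Abs_l2_inverse)
  have w: "nonneg_l2 w"
    unfolding nonneg_l2_def wn nonneg_scalar_of_real by (simp add: m_def c)
  have yw: "nonneg_l2 (y - w)"
    by (subst nonneg_l2_diff_iff [OF yn wn]) (simp add: m_def)
  have qw: "nonneg_l2 (q - w)"
    by (subst nonneg_l2_diff_iff [OF qn wn]) (simp add: m_def)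
  have Pq: "P q = q"
    by (simp add: q_def p_def bounded_operatorD(5) [OF bP] PP)
  note Pwn = nonneg_l2D [OF pos [OF w]]
  \<comment> \<open>\<open>P\<close> preserves the order and fixes \<open>y\<close> and
    \<open>q\<close>, so \<open>P w\<close> lies below both and hence below their infimum
    \<open>w\<close>.\<close>
  have Pyw: "nonneg_l2 (y - P w)" and Pqw: "nonneg_l2 (q - P w)"
    using pos [OF yw] pos [OF qw] by (simp_all add: bounded_operatorD(4) [OF bP] y Pq)
  have wPw: "nonneg_l2 (w - P w)"
    unfolding nonneg_l2_diff_iff [OF wn Pwn]
    using Pyw Pqw nonneg_l2_diff_iff [OF yn Pwn] nonneg_l2_diff_iff [OF qn Pwn] by (simp add: m_def)
  have "inner_l2 (w - P w) p = inner_l2 (P (w - P w)) (unit_l2 i)"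
    by (simp only: p_def sP)
  also have "\<dots> = 0"
    by (simp only: bounded_operatorD(4) [OF bP] PP) simp
  finally have "coord (w - P w) i = 0"
    using nonneg_inner_l2_eq_0 [OF wPw p] pi unfolding p_def by blast
  \<comment> \<open>The choice of \<open>c\<close> makes \<open>y\<close> and \<open>q\<close> agree
    at \<open>i\<close>, so the minimum there equals both.\<close>
  moreover have "norm (coord y i) = c * norm (coord p i)"
    using pi by (simp add: c_def p_def)
  then have "coord w i = coord q i"
    unfolding wn qn m_def by simp
  ultimately have "coord (P (q - w)) i = 0"
    by (simp add: bounded_operatorD(4) [OF bP] Pq)
  then have "inner_l2 (q - w) p = 0"
    unfolding p_def using sP [of "q - w" "unit_l2 i"] by simp
  then have z: "coord q n = coord w n \<or> coord p n = 0" for n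
    using nonneg_inner_l2_eq_0 [OF qw p, of n] by simp
  \<comment> \<open>Where \<open>p\<close> vanishes, so do \<open>q\<close> and the minimum
    \<open>w\<close>.\<close>
  have "q = w"
  proof (rule l2_eqI)
    fix n
    show "coord q n = coord w n"
      using z [of n] by (auto simp: qn wn m_def)
  qed
  then show ?thesis
    using yw by (simp add: q_def p_def)
qed

text \<open>The remainder \<open>x\<close> after subtracting the multiple of column \<open>i\<close>
  is nonnegative and orthogonal to that column. Disjointness of supports makes it orthogonal to
  \<open>S (unit_l2 j)\<close> too, hence to itself.\<close>

lemma column_comp_adjoint:
  fixes S :: "'a::real_or_complex l2 \<Rightarrow> 'a l2"
  assumes S: "lattice_positive S" "lattice_positive (adjoint_op S)"
    and P: "projection (S \<circ> adjoint_op S)" and Q: "projection (adjoint_op S \<circ> S)"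
    and ij: "entry S i j \<noteq> 0"
  shows "\<exists>c\<ge>0. S (unit_l2 j) = c *\<^sub>R S (adjoint_op S (unit_l2 i))"
proof -
  let ?A = "adjoint_op S"
  note bS = lattice_positiveD(1) [OF S(1)] and bA = lattice_positiveD(1) [OF S(2)]
  define s where "s = S (unit_l2 j)"
  define r where "r = ?A (unit_l2 i)"
  define p where "p = S r"
  have s: "nonneg_l2 s" and r: "nonneg_l2 r"
    unfolding s_def r_def by (simp_all add: lattice_positiveD S)
  then have p: "nonneg_l2 p"
    unfolding p_def by (simp add: lattice_positiveD S)
  have ri: "coord r j = conjugate (coord s i)"
    using inner_l2_commute [of "unit_l2 j" r] adjoint_op' [OF bS, of "unit_l2 i" "unit_l2 j"]
    by (metis inner_l2_commute inner_l2_unit_right r_def s_def)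
  have si: "coord s i \<noteq> 0"
    using ij by (simp add: entry_def s_def)
  then have rj: "coord r j \<noteq> 0"
    unfolding ri by (metis norm_conjugate norm_eq_zero)
  \<comment> \<open>\<open>S\<close> is a partial isometry: \<open>?A\<close> kills the difference
    because \<open>?A \<circ> S\<close> is idempotent. So \<open>s\<close> is fixed by
    \<open>S \<circ> ?A\<close>.\<close>
  have SAS: "S (?A (S x)) = S x" for x
  proof -
    have Q': "?A (S (?A (S x))) = ?A (S x)"
      using Q by (simp add: projection_def fun_eq_iff)
    have "inner_l2 (S (?A (S x)) - S x) (S (?A (S x)) - S x)
        = inner_l2 (?A (S (?A (S x)) - S x)) (?A (S x) - x)"
      by (simp only: bounded_operatorD(4) [OF bS, symmetric] adjoint_op' [OF bS])
    also have "\<dots> = 0"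
      by (simp add: bounded_operatorD(4) [OF bA] Q')
    finally show ?thesis
      by (simp add: inner_l2_same)
  qed
  have pp: "coord p i = of_real ((norm r)\<^sup>2)"
    using adjoint_op' [OF bS, of "unit_l2 i" r] inner_l2_same [of r]
    by (metis inner_l2_unit_right adjoint_op [OF bS] p_def r_def)
  have pi: "coord p i \<noteq> 0"
    using rj unfolding pp by auto
  define c where "c = norm (coord s i) / norm (coord p i)"
  have pos: "lattice_positive (S \<circ> ?A)"
    using S by (simp add: lattice_positive_def bounded_operator_comp del: o_apply) simp
  define x where "x = s - c *\<^sub>R p"
  have x: "nonneg_l2 x"
    using column_le_fixed_vector [OF P pos s, of i] pi
    by (simp add: x_def c_def s_def p_def r_def SAS)
  have Ps: "S (?A s) = s" and Pp: "S (?A p) = p"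
    by (simp_all add: s_def p_def SAS)
  then have Px: "S (?A x) = x"
    by (simp add: x_def bounded_operatorD(4,5) [OF bS] bounded_operatorD(4,5) [OF bA])
  have "coord x i = of_real (norm (coord s i)) - of_real c * of_real (norm (coord p i))"
    using nonneg_l2D [OF s, of i] nonneg_l2D [OF p, of i] by (simp add: x_def scaleR_conv_of_real)
  then have xi: "coord x i = 0"
    using pi by (simp add: c_def)
  \<comment> \<open>As \<open>x\<close> is fixed by \<open>S \<circ> ?A\<close>, this inner product
    is its \<open>i\<close>-th coordinate, which \<open>c\<close> was chosen to cancel.\<close>
  have xp: "inner_l2 x p = 0"
  proof -
    have "inner_l2 x p = inner_l2 (S (?A x)) (unit_l2 i)"
      by (simp only: p_def r_def adjoint_op [OF bS] adjoint_op' [OF bS])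
    then show ?thesis
      by (simp add: Px xi)
  qed
  have "inner_l2 (?A x) r = 0"
    using xp by (simp only: p_def adjoint_op' [OF bS])
  \<comment> \<open>Positivity of \<open>?A\<close> enters here: \<open>?A x\<close> and
    \<open>r\<close> are nonnegative and orthogonal, and \<open>r\<close> is nonzero at
    \<open>j\<close>.\<close>
  then have "coord (?A x) j = 0"
    using nonneg_inner_l2_eq_0 [OF lattice_positiveD(2) [OF S(2) x] r] rj by blast
  then have "inner_l2 (?A x) (unit_l2 j) = 0"
    by simp
  then have "inner_l2 x s = 0"
    by (simp only: s_def adjoint_op' [OF bS])
  then have "inner_l2 x (s - c *\<^sub>R p) = 0"
    by (simp add: inner_l2_diff_right inner_l2_scaleR_right xp)
  then have "x = 0"
    by (simp add: inner_l2_same flip: x_def)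
  moreover have "0 \<le> c"
    by (simp add: c_def)
  ultimately show ?thesis
    by (auto simp: x_def s_def p_def r_def)
qed

text \<open>Column \<open>j\<close> of \<open>S\<close> is \<open>c\<close> times column
  \<open>i\<close> of the projection, whose squared norm and \<open>i\<close>-th entry are both
  \<open>\<xi>\<close>. Hence \<open>\<eta> = c^2 * \<xi>\<close>, and the entry is
  \<open>c * \<xi>\<close>.\<close>

lemma entry_eq_sqrt:
  fixes S :: "'a::real_or_complex l2 \<Rightarrow> 'a l2"
  assumes S: "lattice_positive S" "lattice_positive (adjoint_op S)"
    and P: "projection (S \<circ> adjoint_op S)" and Q: "projection (adjoint_op S \<circ> S)"
    and ij: "entry S i j \<noteq> 0"
  defines "\<xi> \<equiv> (norm (adjoint_op S (unit_l2 i)))\<^sup>2" and "\<eta> \<equiv> (norm (S (unit_l2 j)))\<^sup>2"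
  shows "entry (S \<circ> adjoint_op S) i i = of_real \<xi>" "entry (adjoint_op S \<circ> S) j j = of_real \<eta>"
    "entry S i j = of_real (sqrt (\<xi> * \<eta>))"
proof -
  let ?A = "adjoint_op S"
  note bS = lattice_positiveD(1) [OF S(1)]
  have 1: "inner_l2 (S (?A (unit_l2 i))) (unit_l2 i) = of_real \<xi>"
    unfolding \<xi>_def by (simp only: adjoint_op [OF bS] inner_l2_same)
  then show \<xi>: "entry (S \<circ> ?A) i i = of_real \<xi>"
    by (simp add: entry_def)
  have "inner_l2 (?A (S (unit_l2 j))) (unit_l2 j) = of_real \<eta>"
    unfolding \<eta>_def by (simp only: adjoint_op' [OF bS] inner_l2_same)
  then show "entry (?A \<circ> S) j j = of_real \<eta>"
    by (simp add: entry_def)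
  obtain c where c: "0 \<le> c" "S (unit_l2 j) = c *\<^sub>R S (?A (unit_l2 i))"
    using column_comp_adjoint [OF S P Q ij] by blast
  have "(of_real ((norm (S (?A (unit_l2 i))))\<^sup>2) :: 'a)
      = inner_l2 (S (?A (S (?A (unit_l2 i))))) (unit_l2 i)"
    by (simp only: adjoint_op [OF bS, of _ "unit_l2 i"] adjoint_op' [OF bS] inner_l2_same)
  also have "\<dots> = of_real \<xi>"
    using P 1 by (simp only: projection_def fun_eq_iff o_apply)
  finally have "(norm (S (?A (unit_l2 i))))\<^sup>2 = \<xi>"
    by (simp only: of_real_eq_iff)
  then have "\<eta> = c\<^sup>2 * \<xi>"
    unfolding \<eta>_def c(2) by (simp add: power_mult_distrib)
  then have "\<xi> * \<eta> = (c * \<xi>)\<^sup>2"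
    by (simp add: power2_eq_square)
  moreover have "0 \<le> c * \<xi>"
    using c(1) by (simp add: \<xi>_def)
  ultimately have "sqrt (\<xi> * \<eta>) = c * \<xi>"
    by simp
  moreover have "entry S i j = of_real (c * \<xi>)"
    using \<xi> c(2) by (simp add: entry_def scaleR_conv_of_real)
  ultimately show "entry S i j = of_real (sqrt (\<xi> * \<eta>))"
    by simp
qed

theorem theorem4p6:
  fixes \<S> :: "('a::real_or_complex l2 \<Rightarrow> 'a l2) set"
  assumes "op_semigroup \<S>"
    and "self_adjoint_collection \<S>"
    and "\<forall>S\<in>\<S>. lattice_positive S"
    and "((\<forall>S\<in>\<S>. trace_class S) \<and> finite {trace_op S | S. S \<in> psd_part \<S>})
       \<or> (\<forall>i. finite {entry S i i | S. S \<in> psd_part \<S>})"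
  shows "\<forall>S\<in>\<S>. projection (S \<circ> adjoint_op S) \<and> projection (adjoint_op S \<circ> S) \<and>
    (\<forall>i j. entry S i j \<noteq> 0 \<longrightarrow>
      (\<exists>\<xi> \<eta> :: real. \<xi> \<ge> 0 \<and> \<eta> \<ge> 0 \<and>
        (\<exists>k. entry (S \<circ> adjoint_op S) k k = of_real \<xi>) \<and>
        (\<exists>l. entry (adjoint_op S \<circ> S) l l = of_real \<eta>) \<and>
        entry S i j = of_real (sqrt (\<xi> * \<eta>))))"
proof
  fix S
  assume S: "S \<in> \<S>"
  then have A: "adjoint_op S \<in> \<S>"
    using assms(2) by (simp add: self_adjoint_collection_def)
  have bdd: "\<And>S. S \<in> \<S> \<Longrightarrow> bounded_operator S"
    using assms(3) lattice_positiveD(1) by blast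
  note proj = comp_adjoint_projection [OF assms(1,2) bdd assms(4)]
  have P: "projection (S \<circ> adjoint_op S)"
    by (rule proj [OF _ S])
  \<comment> \<open>The first projection result, applied to \<open>adjoint_op S\<close>, whose
    adjoint is \<open>S\<close>.\<close>
  have Q: "projection (adjoint_op S \<circ> S)"
    using proj [OF _ A] by (simp only: adjoint_adjoint [OF bdd [OF S]])
  have lp: "lattice_positive S" "lattice_positive (adjoint_op S)"
    using assms(3) S A by blast+
  show "projection (S \<circ> adjoint_op S) \<and> projection (adjoint_op S \<circ> S) \<and>
    (\<forall>i j. entry S i j \<noteq> 0 \<longrightarrow>
      (\<exists>\<xi> \<eta> :: real. \<xi> \<ge> 0 \<and> \<eta> \<ge> 0 \<and>
        (\<exists>k. entry (S \<circ> adjoint_op S) k k = of_real \<xi>) \<and>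
        (\<exists>l. entry (adjoint_op S \<circ> S) l l = of_real \<eta>) \<and>
        entry S i j = of_real (sqrt (\<xi> * \<eta>))))"
    using P Q entry_eq_sqrt [OF lp P Q] zero_le_power2 by blast
qed

end
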